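(* Let $G$ be a group, let $A=(A,+)$ be a $G$-module, and suppose moreover that $(A,+,\cdot)$ is a brace. Denote the action of $\lambda\in G$ on $A$ by $f_\lambda$. Let $\phi:G\times A\to G$ be a map. Define multiplications $\cdot_\lambda$ ($\lambda\in G$) on $A$ by $$a\cdot_\lambda b:=f_\lambda^{-1}\bigl(f_{\phi(\lambda,b)}(a)\cdot f_\lambda(b)+f_{\phi(\lambda,b)}(a)\bigr)-a\qquad(a,b\in A),$$ and put $a*_\lambda b:=a\cdot_\lambda b+a+b$. Then $(A,G,\phi;+,\{\cdot_\lambda\}_{\lambda\in G})$ is a dynamical brace if and only if $$f_{\phi(\lambda,\,b*_\lambda a)}=f_{\phi(\phi(\lambda,a),b)}\qquad\text{for all }(\lambda,a,b)\in G\times A\times A.$$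
   Context: Brace: an abelian group $(A,+)$ with a multiplication (binary operation) $\cdot:A\times A\to A$ is a brace if for all $a,b,c\in A$: (1) $(a+b)\cdot c=a\cdot c+b\cdot c$; (2) $a\cdot(b\cdot c+b+c)=(a\cdot b)\cdot c+a\cdot b+a\cdot c$; (3) the map $\gamma(b):a\mapsto a\cdot b+a$ is bijective. Dynamical brace: Let $H$ be a non-empty set, $(A,+)$ an abelian group with a family of multiplications $\{\cdot_\lambda:A\times A\to A\}_{\lambda\in H}$, and $\phi:H\times A\to H$ a map. $(A,H,\phi;+,\{\cdot_\lambda\}_{\lambda\in H})$ is called a dynamical brace (d-brace) if for all $(\lambda,a,b,c)\in H\times A\times A\times A$: 1. $(a+b)\cdot_\lambda c=a\cdot_\lambda c+b\cdot_\lambda c$; 2. $a\cdot_\lambda(b\cdot_\lambda c+b+c)=(a\cdot_{\phi(\lambda,c)}b)\cdot_\lambda c+a\cdot_{\phi(\lambda,c)}b+a\cdot_\lambda c$; 3. the map $\gamma_\lambda(b):A\to A$, $a\mapsto a\cdot_\lambda b+a$, is bijective. *)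

theory Defs
  imports "HOL-Algebra.Algebra"
begin

text \<open>
  The additive group \<open>(A, +)\<close> is given by the additive part of a ring record; the locale
  \<^locale>\<open>abelian_group\<close> constrains nothing else, so the fields \<open>mult\<close> and \<open>one\<close> of the record are
  arbitrary and never used. Brace multiplications are separate functions.
\<close>

locale brace = abelian_group A for A (structure) +
  fixes bmult :: "'a \<Rightarrow> 'a \<Rightarrow> 'a"  (infixl \<open>\<cdot>\<close> 70)
  assumes bmult_closed: "\<lbrakk>a \<in> carrier A; b \<in> carrier A\<rbrakk> \<Longrightarrow> a \<cdot> b \<in> carrier A"
    and bmult_distrib: "\<lbrakk>a \<in> carrier A; b \<in> carrier A; c \<in> carrier A\<rbrakk> \<Longrightarrow>
      (a \<oplus> b) \<cdot> c = a \<cdot> c \<oplus> b \<cdot> c"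
    and bmult_assoc: "\<lbrakk>a \<in> carrier A; b \<in> carrier A; c \<in> carrier A\<rbrakk> \<Longrightarrow>
      a \<cdot> (b \<cdot> c \<oplus> b \<oplus> c) = (a \<cdot> b) \<cdot> c \<oplus> a \<cdot> b \<oplus> a \<cdot> c"
    and gamma_bij: "b \<in> carrier A \<Longrightarrow> bij_betw (\<lambda>a. a \<cdot> b \<oplus> a) (carrier A) (carrier A)"

locale dynamical_brace = abelian_group A for A (structure) +
  fixes H :: "'h set"
    and \<phi> :: "'h \<Rightarrow> 'a \<Rightarrow> 'h"
    and dmult :: "'h \<Rightarrow> 'a \<Rightarrow> 'a \<Rightarrow> 'a"
  assumes H_nonempty: "H \<noteq> {}"
    and \<phi>_closed: "\<lbrakk>\<mu> \<in> H; a \<in> carrier A\<rbrakk> \<Longrightarrow> \<phi> \<mu> a \<in> H"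
    and dmult_closed: "\<lbrakk>\<mu> \<in> H; a \<in> carrier A; b \<in> carrier A\<rbrakk> \<Longrightarrow> dmult \<mu> a b \<in> carrier A"
    and dmult_distrib: "\<lbrakk>\<mu> \<in> H; a \<in> carrier A; b \<in> carrier A; c \<in> carrier A\<rbrakk> \<Longrightarrow>
      dmult \<mu> (a \<oplus> b) c = dmult \<mu> a c \<oplus> dmult \<mu> b c"
    and dmult_assoc: "\<lbrakk>\<mu> \<in> H; a \<in> carrier A; b \<in> carrier A; c \<in> carrier A\<rbrakk> \<Longrightarrow>
      dmult \<mu> a (dmult \<mu> b c \<oplus> b \<oplus> c) =
        dmult \<mu> (dmult (\<phi> \<mu> c) a b) c \<oplus> dmult (\<phi> \<mu> c) a b \<oplus> dmult \<mu> a c"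
    and dgamma_bij: "\<lbrakk>\<mu> \<in> H; b \<in> carrier A\<rbrakk> \<Longrightarrow>
      bij_betw (\<lambda>a. dmult \<mu> a b \<oplus> a) (carrier A) (carrier A)"

text \<open>
  Elements of \<^const>\<open>AutoGroup\<close> are extensional on the carrier, so equality of two operators
  \<open>f \<mu> = f \<nu>\<close> is their equality as maps on \<open>A\<close>.
\<close>

locale group_module = group G + abelian_group A
  for G (structure) and A (structure) +
  fixes f
  assumes action_hom: "f \<in> hom G (AutoGroup (add_monoid A))"

definition twisted_mult ::
  "('a, 'm) ring_scheme \<Rightarrow> ('a \<Rightarrow> 'a \<Rightarrow> 'a) \<Rightarrow> ('g \<Rightarrow> 'a \<Rightarrow> 'a) \<Rightarrow> ('g \<Rightarrow> 'a \<Rightarrow> 'g) \<Rightarrow>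
    'g \<Rightarrow> 'a \<Rightarrow> 'a \<Rightarrow> 'a"
  where "twisted_mult A m f \<phi> \<mu> a b =
    inv_into (carrier A) (f \<mu>)
      (m (f (\<phi> \<mu> b) a) (f \<mu> b) \<oplus>\<^bsub>A\<^esub> f (\<phi> \<mu> b) a) \<ominus>\<^bsub>A\<^esub> a"

definition twisted_star ::
  "('a, 'm) ring_scheme \<Rightarrow> ('a \<Rightarrow> 'a \<Rightarrow> 'a) \<Rightarrow> ('g \<Rightarrow> 'a \<Rightarrow> 'a) \<Rightarrow> ('g \<Rightarrow> 'a \<Rightarrow> 'g) \<Rightarrow>
    'g \<Rightarrow> 'a \<Rightarrow> 'a \<Rightarrow> 'a"
  where "twisted_star A m f \<phi> \<mu> a b = twisted_mult A m f \<phi> \<mu> a b \<oplus>\<^bsub>A\<^esub> a \<oplus>\<^bsub>A\<^esub> b"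

end

theory Submission
  imports Defs
begin

text \<open>
  Write \<open>\<gamma> b\<close> for the additive bijection \<open>a \<mapsto> a \<cdot> b + a\<close>. The associativity-like brace
  axiom says \<open>\<gamma> (b * c) = \<gamma> c \<circ> \<gamma> b\<close>, and its dynamical version says
  \<open>\<gamma>\<^sub>\<mu> (b *\<^sub>\<mu> c) = \<gamma>\<^sub>\<mu> c \<circ> \<gamma>\<^bsub>\<phi> \<mu> c\<^esub> b\<close>. For the twisted multiplication
  \<open>\<gamma>\<^sub>\<mu> b = (f \<mu>)\<inverse> \<circ> \<gamma> (f \<mu> b) \<circ> f (\<phi> \<mu> b)\<close>, which is always an additive
  bijection, and \<open>f \<mu>\<close> carries \<open>b *\<^sub>\<mu> c\<close> to \<open>f (\<phi> \<mu> c) b * f \<mu> c\<close>. Hence both sides of the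
  dynamical axiom start with the same bijections, and cancelling these leaves
  \<open>f (\<phi> \<mu> (b *\<^sub>\<mu> c)) = f (\<phi> (\<phi> \<mu> c) b)\<close>.
\<close>

context brace
begin

definition gamma :: "'a \<Rightarrow> 'a \<Rightarrow> 'a"
  where "gamma b a = a \<cdot> b \<oplus> a"

lemma gamma_closed: "\<lbrakk>a \<in> carrier A; b \<in> carrier A\<rbrakk> \<Longrightarrow> gamma b a \<in> carrier A"
  by (simp add: gamma_def bmult_closed)

lemma bij_betw_gamma: "b \<in> carrier A \<Longrightarrow> bij_betw (gamma b) (carrier A) (carrier A)"
  using gamma_bij unfolding gamma_def by simp

lemma gamma_eq_iff:
  "\<lbrakk>a \<in> carrier A; b \<in> carrier A; c \<in> carrier A\<rbrakk> \<Longrightarrow> gamma c a = gamma c b \<longleftrightarrow> a = b"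
  using bij_betw_gamma[of c] by (auto simp: bij_betw_def inj_on_eq_iff)

lemma gamma_add:
  "\<lbrakk>a \<in> carrier A; b \<in> carrier A; c \<in> carrier A\<rbrakk> \<Longrightarrow>
    gamma c (a \<oplus> b) = gamma c a \<oplus> gamma c b"
  by (simp add: gamma_def bmult_distrib bmult_closed a_ac)

text \<open>The inner argument \<open>gamma c b \<oplus> c\<close> is the star product of
  \<open>b\<close> and \<open>c\<close>. Adding \<open>a\<close> to both sides of
  \<open>bmult_assoc\<close> lets distributivity regroup the right side into a composition.\<close>

lemma gamma_star:
  assumes "a \<in> carrier A" "b \<in> carrier A" "c \<in> carrier A"
  shows "gamma (gamma c b \<oplus> c) a = gamma c (gamma b a)"
proof -
  have "gamma (gamma c b \<oplus> c) a = ((a \<cdot> b) \<cdot> c \<oplus> a \<cdot> b \<oplus> a \<cdot> c) \<oplus> a"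
    using assms by (simp only: gamma_def bmult_assoc)
  also have "\<dots> = gamma c (gamma b a)"
    using assms by (simp add: gamma_def bmult_distrib bmult_closed a_ac)
  finally show ?thesis .
qed

end

context group_module
begin

lemma action_bij: "\<mu> \<in> carrier G \<Longrightarrow> bij_betw (f \<mu>) (carrier A) (carrier A)"
  using action_hom by (auto simp: hom_def AutoGroup_def auto_def Bij_def)

lemma action_closed: "\<lbrakk>\<mu> \<in> carrier G; a \<in> carrier A\<rbrakk> \<Longrightarrow> f \<mu> a \<in> carrier A"
  using action_bij bij_betwE by blast

lemma action_add:
  "\<lbrakk>\<mu> \<in> carrier G; a \<in> carrier A; b \<in> carrier A\<rbrakk> \<Longrightarrow>
    f \<mu> (a \<oplus>\<^bsub>A\<^esub> b) = f \<mu> a \<oplus>\<^bsub>A\<^esub> f \<mu> b"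
  using action_hom by (auto simp: hom_def AutoGroup_def auto_def)

text \<open>Both operators are extensional on the carrier, so agreement there is equality of
  functions. This connects the pointwise brace axiom with the operator identity of the
  theorem.\<close>

lemma action_eq_iff:
  assumes "\<mu> \<in> carrier G" "\<nu> \<in> carrier G"
  shows "f \<mu> = f \<nu> \<longleftrightarrow> (\<forall>a\<in>carrier A. f \<mu> a = f \<nu> a)"
proof -
  have "f \<mu> \<in> extensional (carrier A)" "f \<nu> \<in> extensional (carrier A)"
    using assms action_hom by (auto simp: hom_def AutoGroup_def auto_def Bij_def)
  then show ?thesis
    by (auto intro: extensionalityI)
qed

lemma action_inj_iff:
  "\<lbrakk>\<mu> \<in> carrier G; a \<in> carrier A; b \<in> carrier A\<rbrakk> \<Longrightarrow> f \<mu> a = f \<mu> b \<longleftrightarrow> a = b"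
  using action_bij[of \<mu>] by (auto simp: bij_betw_def inj_on_eq_iff)

end

locale twisted_brace = brace A m + group_module G A f
  for A (structure) and m and G and f +
  fixes \<phi>
  assumes phi_closed: "\<phi> \<in> carrier G \<rightarrow> carrier A \<rightarrow> carrier G"
begin

lemma phi_in: "\<lbrakk>\<mu> \<in> carrier G; a \<in> carrier A\<rbrakk> \<Longrightarrow> \<phi> \<mu> a \<in> carrier G"
  using phi_closed by auto

text \<open>This is the map \<gamma> of the twisted multiplication, written as a composition so that
  additivity and bijectivity can be read off from its factors.\<close>

definition twisted_gamma
  where "twisted_gamma \<mu> b a =
    inv_into (carrier A) (f \<mu>) (gamma (f \<mu> b) (f (\<phi> \<mu> b) a))"

abbreviation "tmult \<equiv> twisted_mult A m f \<phi>"
abbreviation "tstar \<equiv> twisted_star A m f \<phi>"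

lemma twisted_gamma_closed:
  assumes "\<mu> \<in> carrier G" "a \<in> carrier A" "b \<in> carrier A"
  shows "twisted_gamma \<mu> b a \<in> carrier A"
  unfolding twisted_gamma_def
  using action_bij[OF assms(1)] assms
  by (metis action_closed gamma_closed phi_in bij_betw_imp_surj_on inv_into_into)

lemma action_twisted_gamma:
  assumes "\<mu> \<in> carrier G" "a \<in> carrier A" "b \<in> carrier A"
  shows "f \<mu> (twisted_gamma \<mu> b a) = gamma (f \<mu> b) (f (\<phi> \<mu> b) a)"
  unfolding twisted_gamma_def
  using action_bij[OF assms(1)] assms
  by (simp add: action_closed gamma_closed phi_in bij_betw_inv_into_right)

lemma tmult_eq: "tmult \<mu> a b = twisted_gamma \<mu> b a \<ominus> a"
  by (simp add: twisted_mult_def twisted_gamma_def gamma_def)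

lemma tmult_closed:
  "\<lbrakk>\<mu> \<in> carrier G; a \<in> carrier A; b \<in> carrier A\<rbrakk> \<Longrightarrow> tmult \<mu> a b \<in> carrier A"
  by (simp add: tmult_eq twisted_gamma_closed)

lemma tmult_add_self:
  assumes "\<mu> \<in> carrier G" "a \<in> carrier A" "b \<in> carrier A"
  shows "tmult \<mu> a b \<oplus> a = twisted_gamma \<mu> b a"
  using assms by (simp add: tmult_eq minus_eq twisted_gamma_closed a_assoc l_neg)

lemma tstar_eq:
  assumes "\<mu> \<in> carrier G" "a \<in> carrier A" "b \<in> carrier A"
  shows "tstar \<mu> a b = twisted_gamma \<mu> b a \<oplus> b"
  using assms by (simp add: twisted_star_def tmult_add_self)

lemma tstar_closed:
  "\<lbrakk>\<mu> \<in> carrier G; a \<in> carrier A; b \<in> carrier A\<rbrakk> \<Longrightarrow> tstar \<mu> a b \<in> carrier A"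
  by (simp add: tstar_eq twisted_gamma_closed)

text \<open>Applying the injective map \<open>f \<mu>\<close> removes the outer inverse and leaves a
  composition of additive maps.\<close>

lemma twisted_gamma_add:
  assumes "\<mu> \<in> carrier G" "a \<in> carrier A" "b \<in> carrier A" "c \<in> carrier A"
  shows "twisted_gamma \<mu> c (a \<oplus> b) = twisted_gamma \<mu> c a \<oplus> twisted_gamma \<mu> c b"
proof -
  have "f \<mu> (twisted_gamma \<mu> c (a \<oplus> b)) = f \<mu> (twisted_gamma \<mu> c a \<oplus> twisted_gamma \<mu> c b)"
    using assms
    by (simp add: action_twisted_gamma action_add gamma_add twisted_gamma_closed
        action_closed phi_in)
  then show ?thesis
    using assms by (simp add: action_inj_iff twisted_gamma_closed)
qed

lemma bij_betw_twisted_gamma: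
  assumes "\<mu> \<in> carrier G" "b \<in> carrier A"
  shows "bij_betw (twisted_gamma \<mu> b) (carrier A) (carrier A)"
proof -
  have "bij_betw (inv_into (carrier A) (f \<mu>) \<circ> (gamma (f \<mu> b) \<circ> f (\<phi> \<mu> b)))
      (carrier A) (carrier A)"
    by (rule bij_betw_trans[OF bij_betw_trans[OF action_bij bij_betw_gamma]
          bij_betw_inv_into[OF action_bij]]) (simp_all add: assms phi_in action_closed)
  then show ?thesis
    by (simp add: twisted_gamma_def[abs_def] comp_def)
qed

text \<open>The right side is the star product of \<open>f (\<phi> \<mu> c) b\<close> and
  \<open>f \<mu> c\<close> in the brace, in the form that \<open>gamma_star\<close> splits.\<close>

lemma action_tstar:
  assumes "\<mu> \<in> carrier G" "b \<in> carrier A" "c \<in> carrier A"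
  shows "f \<mu> (tstar \<mu> b c) = gamma (f \<mu> c) (f (\<phi> \<mu> c) b) \<oplus> f \<mu> c"
  using assms by (simp add: tstar_eq action_add twisted_gamma_closed action_twisted_gamma)

text \<open>Under \<open>f \<mu>\<close> both sides become the same two injective maps
  \<open>gamma\<close>, applied to the two values being compared.\<close>

lemma twisted_gamma_tstar_iff:
  assumes "\<mu> \<in> carrier G" "a \<in> carrier A" "b \<in> carrier A" "c \<in> carrier A"
  shows "twisted_gamma \<mu> (tstar \<mu> b c) a = twisted_gamma \<mu> c (twisted_gamma (\<phi> \<mu> c) b a)
    \<longleftrightarrow> f (\<phi> \<mu> (tstar \<mu> b c)) a = f (\<phi> (\<phi> \<mu> c) b) a" (is "?l = ?r \<longleftrightarrow> ?x = ?y")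
proof -
  note closed = assms phi_in tstar_closed action_closed gamma_closed twisted_gamma_closed
  have "f \<mu> ?l = gamma (f \<mu> c) (gamma (f (\<phi> \<mu> c) b) ?x)"
    by (simp add: closed action_twisted_gamma action_tstar gamma_star)
  moreover have "f \<mu> ?r = gamma (f \<mu> c) (gamma (f (\<phi> \<mu> c) b) ?y)"
    by (simp add: closed action_twisted_gamma)
  moreover have "?l = ?r \<longleftrightarrow> f \<mu> ?l = f \<mu> ?r"
    by (simp add: closed action_inj_iff)
  ultimately show ?thesis
    by (simp add: closed gamma_eq_iff)
qed

lemma tmult_distrib:
  assumes "\<mu> \<in> carrier G" "a \<in> carrier A" "b \<in> carrier A" "c \<in> carrier A"
  shows "tmult \<mu> (a \<oplus> b) c = tmult \<mu> a c \<oplus> tmult \<mu> b c"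
  using assms
  by (simp add: tmult_eq twisted_gamma_add twisted_gamma_closed minus_eq minus_add a_ac)

text \<open>Adding \<open>a\<close> to both sides, which can be cancelled, turns the axiom into the
  composition law for \<open>twisted_gamma\<close>.\<close>

lemma tmult_assoc_iff:
  assumes "\<mu> \<in> carrier G" "a \<in> carrier A" "b \<in> carrier A" "c \<in> carrier A"
  shows "tmult \<mu> a (tmult \<mu> b c \<oplus> b \<oplus> c) =
      tmult \<mu> (tmult (\<phi> \<mu> c) a b) c \<oplus> tmult (\<phi> \<mu> c) a b \<oplus> tmult \<mu> a c
    \<longleftrightarrow> f (\<phi> \<mu> (tstar \<mu> b c)) a = f (\<phi> (\<phi> \<mu> c) b) a" (is "?l = ?r \<longleftrightarrow> ?rhs")
proof -
  note closed = assms phi_in tstar_closed tmult_closed twisted_gamma_closed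
  have l: "?l \<oplus> a = twisted_gamma \<mu> (tstar \<mu> b c) a"
    by (simp add: closed tmult_add_self tstar_eq)
  have "?r \<oplus> a = twisted_gamma \<mu> c (tmult (\<phi> \<mu> c) a b) \<oplus> twisted_gamma \<mu> c a"
    by (simp add: closed tmult_add_self a_assoc)
  \<comment> \<open>Additivity merges the two values into one at
    \<open>tmult (\<phi> \<mu> c) a b \<oplus> a\<close>, itself a value of
    \<open>twisted_gamma (\<phi> \<mu> c) b\<close>.\<close>
  also have "\<dots> = twisted_gamma \<mu> c (twisted_gamma (\<phi> \<mu> c) b a)"
    by (simp add: closed tmult_add_self flip: twisted_gamma_add)
  finally have r: "?r \<oplus> a = twisted_gamma \<mu> c (twisted_gamma (\<phi> \<mu> c) b a)" .
  have "?l = ?r \<longleftrightarrow> ?l \<oplus> a = ?r \<oplus> a"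
    by (simp add: closed)
  then show ?thesis
    unfolding l r twisted_gamma_tstar_iff[OF assms] .
qed

lemma dynamical_brace_iff:
  "dynamical_brace A (carrier G) \<phi> tmult \<longleftrightarrow>
    (\<forall>\<mu>\<in>carrier G. \<forall>a\<in>carrier A. \<forall>b\<in>carrier A.
      f (\<phi> \<mu> (tstar \<mu> b a)) = f (\<phi> (\<phi> \<mu> a) b))"
proof
  assume "dynamical_brace A (carrier G) \<phi> tmult"
  then interpret d: dynamical_brace A "carrier G" \<phi> tmult .
  show "\<forall>\<mu>\<in>carrier G. \<forall>a\<in>carrier A. \<forall>b\<in>carrier A.
      f (\<phi> \<mu> (tstar \<mu> b a)) = f (\<phi> (\<phi> \<mu> a) b)"
    \<comment> \<open>The first factor in \<open>dmult_assoc\<close> serves as the point at which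
      the two operators are compared; the bound \<open>a\<close> of the goal takes the place of
      \<open>c\<close> there.\<close>
    using d.dmult_assoc by (simp add: tmult_assoc_iff action_eq_iff phi_in tstar_closed)
next
  assume cond: "\<forall>\<mu>\<in>carrier G. \<forall>a\<in>carrier A. \<forall>b\<in>carrier A.
      f (\<phi> \<mu> (tstar \<mu> b a)) = f (\<phi> (\<phi> \<mu> a) b)"
  show "dynamical_brace A (carrier G) \<phi> tmult"
  proof unfold_locales
    fix \<mu> b assume "\<mu> \<in> carrier G" "b \<in> carrier A"
    then show "bij_betw (\<lambda>a. tmult \<mu> a b \<oplus> a) (carrier A) (carrier A)"
      \<comment> \<open>\<open>tmult_add_self\<close> holds only on the carrier; the congruence rule
        supplies that membership under the binder.\<close>
      using bij_betw_twisted_gamma by (simp add: tmult_add_self cong: bij_betw_cong)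
  qed (use cond in \<open>auto simp: phi_in tmult_closed tmult_distrib tmult_assoc_iff\<close>)
qed

end

theorem theorem3p3:
  fixes G :: "('g, 'n) monoid_scheme"
    and A :: "('a, 'm) ring_scheme"
    and m :: "'a \<Rightarrow> 'a \<Rightarrow> 'a"
    and f :: "'g \<Rightarrow> 'a \<Rightarrow> 'a"
    and \<phi> :: "'g \<Rightarrow> 'a \<Rightarrow> 'g"
  assumes "group_module G A f"
    and "brace A m"
    and "\<phi> \<in> carrier G \<rightarrow> carrier A \<rightarrow> carrier G"
  shows "dynamical_brace A (carrier G) \<phi> (twisted_mult A m f \<phi>) \<longleftrightarrow>
    (\<forall>\<mu>\<in>carrier G. \<forall>a\<in>carrier A. \<forall>b\<in>carrier A.
      f (\<phi> \<mu> (twisted_star A m f \<phi> \<mu> b a)) = f (\<phi> (\<phi> \<mu> a) b))"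
proof -
  interpret twisted_brace A m G f \<phi>
    using assms by (simp add: twisted_brace_def twisted_brace_axioms_def)
  show ?thesis
    by (rule dynamical_brace_iff)
qed

end
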